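(* Let $\Omega\subset\mathbb{R}^d$ be a bounded, connected, polyhedral open set with Lipschitz boundary, $d\in\{2,3\}$, let $r\in(1,\infty)$, $\delta\in[0,\infty)$, let $\mu:\Omega\to[\mu_-,\mu_+]$ and $a:\Omega\to[a_-,a_+]$ be measurable functions with $\mu_-,\mu_+,a_-,a_+\in(0,\infty)$, and let the $(\mu,\delta,a,r)$-Carreau–Yasuda strain rate-shear stress law be defined, for almost every $x\in\Omega$ and all $\tau\in\mathbb{R}^{d\times d}_{\mathrm s}$, by $$\sigma(x,\tau)=\mu(x)\left(\delta^{a(x)}+|\tau|^{a(x)}\right)^{\frac{r-2}{a(x)}}\tau .$$ Then $\sigma$ is an $r$-power-framed function, i.e. there exist $\sigma_{\mathrm{de}}\in[0,\infty)$ and $\sigma_{\mathrm{hc}},\sigma_{\mathrm{sm}}\in(0,\infty)$ such that, for all $\tau,\eta\in\mathbb{R}^{d\times d}_{\mathrm s}$ with $\tau\neq\eta$ and almost every $x\in\Omega$, $$|\sigma(x,\tau)-\sigma(x,\eta)|\le\sigma_{\mathrm{hc}}\left(\sigma_{\mathrm{de}}^r+|\tau|^r+|\eta|^r\right)^{\frac{r-2}r}|\tau-\eta|,$$ $$(\sigma(x,\tau)-\sigma(x,\eta)):(\tau-\eta)\ge\sigma_{\mathrm{sm}}\left(\sigma_{\mathrm{de}}^r+|\tau|^r+|\eta|^r\right)^{\frac{r-2}r}|\tau-\eta|^2.$$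
   Context: $\mathbb{R}^{d\times d}_{\mathrm s}$ is the set of symmetric real $d\times d$ matrices, $\tau:\eta=\sum_{i,j}\tau_{ij}\eta_{ij}$ is the Frobenius inner product, and $|\tau|=\sqrt{\tau:\tau}$. By convention $\sigma(x,0)=0$ (relevant when $\delta=0$ and $r<2$, where the formula is singular at $\tau=0$). *)

theory Defs
  imports "HOL-Analysis.Analysis"
begin

definition sym_matrices :: "(real ^ 'd ^ 'd) set" where
  "sym_matrices = {A. transpose A = A}"

text \<open>The inner product of \<^typ>\<open>real ^ 'd ^ 'd\<close> is the Frobenius inner product, and its norm
  is therefore the Frobenius norm.\<close>

lemma inner_matrix_Frobenius:
  fixes A B :: "real ^ 'd ^ 'd"
  shows "A \<bullet> B = (\<Sum>i\<in>UNIV. \<Sum>j\<in>UNIV. A $ i $ j * B $ i $ j)"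
  by (simp add: inner_vec_def)

text \<open>The library's \<^const>\<open>polyhedron\<close> is a convex notion; polyhedral domains need not be convex.\<close>

definition polyhedral_domain :: "'a::euclidean_space set \<Rightarrow> bool" where
  "polyhedral_domain \<Omega> \<longleftrightarrow> (\<exists>F. finite F \<and> (\<forall>P\<in>F. polytope P) \<and> \<Omega> = interior (\<Union>F))"

text \<open>Near every boundary point, the set is the strict epigraph, in some direction \<open>\<nu>\<close>, of a
  Lipschitz function \<open>g\<close> on the hyperplane through the origin orthogonal to \<open>\<nu>\<close>. Requiring \<open>g\<close> to
  be defined on all of the hyperplane is no restriction, as Lipschitz functions extend.\<close>

definition lipschitz_boundary :: "'a::euclidean_space set \<Rightarrow> bool" where
  "lipschitz_boundary \<Omega> \<longleftrightarrow>
     (\<forall>x\<in>frontier \<Omega>. \<exists>\<nu> g L \<epsilon>. norm \<nu> = 1 \<and> \<epsilon> > 0 \<and>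
        L-lipschitz_on {v. v \<bullet> \<nu> = 0} (g :: 'a \<Rightarrow> real) \<and>
        \<Omega> \<inter> ball x \<epsilon> = {y \<in> ball x \<epsilon>. g (y - (y \<bullet> \<nu>) *\<^sub>R \<nu>) < y \<bullet> \<nu>})"

text \<open>At \<open>\<tau> = 0\<close> the value is \<open>0\<close>, whatever the scalar factor. This is the usual convention in the
  case \<open>\<delta> = 0\<close>, \<open>r < 2\<close>, where the factor is singular.\<close>

definition carreau_yasuda ::
  "('x \<Rightarrow> real) \<Rightarrow> real \<Rightarrow> ('x \<Rightarrow> real) \<Rightarrow> real \<Rightarrow> 'x \<Rightarrow> real ^ 'd ^ 'd \<Rightarrow> real ^ 'd ^ 'd" where
  "carreau_yasuda \<mu> \<delta> a r x \<tau> =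
     (\<mu> x * (\<delta> powr a x + norm \<tau> powr a x) powr ((r - 2) / a x)) *\<^sub>R \<tau>"

definition power_framed ::
  "(real ^ 'd) set \<Rightarrow> real \<Rightarrow> (real ^ 'd \<Rightarrow> real ^ 'd ^ 'd \<Rightarrow> real ^ 'd ^ 'd) \<Rightarrow> bool" where
  "power_framed \<Omega> r \<sigma> \<longleftrightarrow>
     (\<exists>\<sigma>de \<sigma>hc \<sigma>sm. \<sigma>de \<ge> 0 \<and> \<sigma>hc > 0 \<and> \<sigma>sm > 0 \<and>
       (\<forall>\<tau>\<in>sym_matrices. \<forall>\<eta>\<in>sym_matrices. \<tau> \<noteq> \<eta> \<longrightarrow>
         (AE x in lebesgue_on \<Omega>.
            norm (\<sigma> x \<tau> - \<sigma> x \<eta>)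
              \<le> \<sigma>hc * (\<sigma>de powr r + norm \<tau> powr r + norm \<eta> powr r) powr ((r - 2) / r)
                   * norm (\<tau> - \<eta>) \<and>
            (\<sigma> x \<tau> - \<sigma> x \<eta>) \<bullet> (\<tau> - \<eta>)
              \<ge> \<sigma>sm * (\<sigma>de powr r + norm \<tau> powr r + norm \<eta> powr r) powr ((r - 2) / r)
                   * (norm (\<tau> - \<eta>))\<^sup>2)))"

end

theory Submission
  imports Defs
begin

text \<open>Put \<open>\<rho>(t) = (\<delta>\<^sup>a + t\<^sup>a)\<^bsup>1/a\<^esup>\<close>, so that \<open>\<sigma>(\<tau>) = \<mu> \<rho>(|\<tau>|)\<^bsup>r-2\<^esup> \<tau>\<close>. All that matters about \<open>\<rho>\<close> is
  that \<open>\<rho>(t)\<close> is increasing, \<open>\<rho>(t)/t\<close> is decreasing, and \<open>\<rho>(t)\<close> is comparable to \<open>max \<delta> t\<close>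
  uniformly in \<open>a \<ge> a\<^sub>-\<close>. For \<open>s = |\<tau>| \<ge> t = |\<eta>|\<close>, the two monotonicity properties and Bernoulli's
  inequality compare \<open>\<rho>(s)\<^bsup>r-2\<^esup> s - \<rho>(t)\<^bsup>r-2\<^esup> t\<close> with \<open>\<rho>(s)\<^bsup>r-2\<^esup> (s - t)\<close>. This passes to matrices
  by splitting off the angular part \<open>s t - \<tau> : \<eta>\<close>, and the comparability replaces \<open>\<rho>(s)\<close> by
  \<open>(\<delta>\<^sup>r + s\<^sup>r + t\<^sup>r)\<^bsup>1/r\<^esup>\<close>; hence \<open>\<sigma>\<^sub>d\<^sub>e = \<delta>\<close> works.\<close>

section \<open>Bernoulli's inequality for real exponents, and comparison of powers\<close>

lemma powr_le_one_plus:
  fixes x \<alpha> :: real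
  assumes "0 \<le> x" "0 \<le> \<alpha>" "\<alpha> \<le> 1"
  shows "x powr \<alpha> \<le> 1 + \<alpha> * (x - 1)"
proof (cases "x = 0")
  case False
  \<comment> \<open>Weighted AM-GM for \<open>x\<close> and 1.\<close>
  have "x powr \<alpha> * 1 powr (1 - \<alpha>) \<le> \<alpha> * x + (1 - \<alpha>) * 1"
    using assms False by (intro Youngs_inequality_0) auto
  then show ?thesis by (simp add: algebra_simps)
qed (use assms in simp)

text \<open>The concave case, applied to \<open>x powr \<alpha>\<close> with exponent
  \<open>1 / \<alpha>\<close>.\<close>

lemma powr_ge_one_plus:
  fixes x \<alpha> :: real
  assumes "0 \<le> x" "1 \<le> \<alpha>"
  shows "1 + \<alpha> * (x - 1) \<le> x powr \<alpha>"
proof -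
  have "x = (x powr \<alpha>) powr (1 / \<alpha>)"
    using assms by (simp add: powr_powr)
  also have "\<dots> \<le> 1 + 1 / \<alpha> * (x powr \<alpha> - 1)"
    using assms by (intro powr_le_one_plus) auto
  finally have "\<alpha> * x \<le> \<alpha> * (1 + 1 / \<alpha> * (x powr \<alpha> - 1))"
    using assms by (intro mult_left_mono) auto
  then show ?thesis
    using assms by (simp add: algebra_simps)
qed

text \<open>Comparability in both directions lets one bound serve either sign of \<open>m\<close>:
  for negative \<open>m\<close> the power is antitone and \<open>y \<le> B * x\<close> is used
  instead.\<close>

lemma powr_comparable:
  fixes x y B m :: real
  assumes "0 < x" "0 < y" "x \<le> B * y" "y \<le> B * x" "1 \<le> B"
  shows "x powr m \<le> B powr \<bar>m\<bar> * y powr m"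
proof (cases "0 \<le> m")
  case True
  then show ?thesis
    using powr_mono2[of m x "B * y"] assms by (simp add: powr_mult)
next
  case False
  have "(B * x) powr m \<le> y powr m"
    using assms False by (intro powr_mono2') auto
  then have "B powr \<bar>m\<bar> * (B * x) powr m \<le> B powr \<bar>m\<bar> * y powr m"
    by (intro mult_left_mono) auto
  moreover have "B powr \<bar>m\<bar> * (B * x) powr m = x powr m"
    using assms False by (simp add: powr_mult powr_minus)
  ultimately show ?thesis by simp
qed

section \<open>Scalar estimates for r at most 2 and at least 2\<close>

text \<open>Here \<open>p\<close>, \<open>q\<close> stand for \<rho>(s), \<rho>(t), and
  \<open>t * p \<le> s * q\<close> is the decrease of \<rho>(t)/t, free of division so that
  \<open>t = 0\<close> is allowed. For positive \<open>t\<close> it gives p/q \<le> s/t, and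
  Bernoulli with exponent \<open>2 - r\<close> bounds \<open>?Q\<close> by \<open>?P\<close>. The
  second bound follows from the first because \<open>?P \<le> ?Q\<close>.\<close>

lemma weighted_difference_singular:
  fixes s t p q r :: real
  assumes "0 \<le> t" "t \<le> s" "0 < s" "0 \<le> q" "q \<le> p" "0 < p" "t * p \<le> s * q"
    and "1 < r" "r \<le> 2"
  shows "(r - 1) * p powr (r - 2) * (s - t) \<le> p powr (r - 2) * s - q powr (r - 2) * t"
    and "\<bar>p powr (r - 2) - q powr (r - 2)\<bar> * t \<le> p powr (r - 2) * (s - t)"
proof -
  let ?P = "p powr (r - 2)" and ?Q = "q powr (r - 2)"
  have "(r - 1) * ?P * (s - t) \<le> ?P * s - ?Q * t \<and> \<bar>?P - ?Q\<bar> * t \<le> ?P * (s - t)"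
  \<comment> \<open>At \<open>t = 0\<close> also \<open>q\<close> may be 0, which makes p/q
    unusable, but \<open>?Q\<close> occurs only multiplied by \<open>t\<close>.\<close>
  proof (cases "t = 0")
    case True
    have "(r - 1) * (?P * s) \<le> 1 * (?P * s)"
      using assms by (intro mult_right_mono) auto
    then show ?thesis
      using True assms by (simp add: algebra_simps)
  next
    case False
    then have t: "0 < t" using assms by simp
    have q: "0 < q"
    proof -
      have "0 < t * p" using t assms by simp
      then have "0 < s * q" using assms by linarith
      then show ?thesis using assms by (simp add: zero_less_mult_iff)
    qed
    have "(p / q) powr (2 - r) = (q / p) powr (r - 2)"
      using powr_minus[of "p / q" "r - 2"] inverse_powr[of "q / p" "r - 2"] by simp
    then have "?Q = ?P * (p / q) powr (2 - r)"
      using assms by (simp add: powr_divide)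
    also have "\<dots> \<le> ?P * (s / t) powr (2 - r)"
      using assms t q by (intro mult_left_mono powr_mono2) (auto simp: field_simps)
    also have "\<dots> \<le> ?P * (1 + (2 - r) * (s / t - 1))"
      using assms t by (intro mult_left_mono powr_le_one_plus) auto
    finally have "?Q * t \<le> ?P * (1 + (2 - r) * (s / t - 1)) * t"
      using t by (intro mult_right_mono) auto
    also have "\<dots> = ?P * s - (r - 1) * ?P * (s - t)"
      using t by (simp add: field_simps)
    finally have 1: "(r - 1) * ?P * (s - t) \<le> ?P * s - ?Q * t" by simp
    have "0 \<le> (r - 1) * ?P * (s - t)"
      using assms by auto
    then have "(?Q - ?P) * t \<le> ?P * (s - t)"
      using 1 by (simp add: algebra_simps)
    moreover have "?P \<le> ?Q"
      using assms q by (intro powr_mono2') auto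
    ultimately show ?thesis using 1 by simp
  qed
  then show "(r - 1) * ?P * (s - t) \<le> ?P * s - ?Q * t" "\<bar>?P - ?Q\<bar> * t \<le> ?P * (s - t)"
    by auto
qed

text \<open>Now \<open>?Q \<le> ?P\<close>, so the first bound is immediate and the second needs
  \<open>?Q\<close> from below.\<close>

lemma weighted_difference_degenerate:
  fixes s t p q r :: real
  assumes "0 \<le> t" "t \<le> s" "0 < s" "0 \<le> q" "q \<le> p" "0 < p" "t * p \<le> s * q"
    and "2 \<le> r"
  shows "p powr (r - 2) * (s - t) \<le> p powr (r - 2) * s - q powr (r - 2) * t"
    and "\<bar>p powr (r - 2) - q powr (r - 2)\<bar> * t \<le> (r - 2) * p powr (r - 2) * (s - t)"
proof -
  let ?P = "p powr (r - 2)" and ?Q = "q powr (r - 2)"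
  have QP: "?Q \<le> ?P"
    using assms by (intro powr_mono2) auto
  then have "0 \<le> (?P - ?Q) * t"
    using assms by simp
  then show "?P * (s - t) \<le> ?P * s - ?Q * t"
    by (simp add: algebra_simps)
  \<comment> \<open>Bernoulli needs an exponent of at least 1, which \<open>r - 2\<close> may fail
    to be; the extra factor \<open>t / s\<close> raises it to \<open>r - 1\<close>.\<close>
  have "1 + (r - 1) * (t / s - 1) \<le> (t / s) powr (r - 1)"
    using assms by (intro powr_ge_one_plus) auto
  also have "\<dots> = (t / s) powr (r - 2) * (t / s)"
    using powr_mult_base[of "t / s" "r - 2"] assms by (simp add: mult.commute)
  also have "\<dots> \<le> (q / p) powr (r - 2) * (t / s)"
    using assms by (intro mult_right_mono powr_mono2) (auto simp: field_simps)
  also have "\<dots> = ?Q / ?P * (t / s)"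
    by (simp add: powr_divide)
  finally have "?P * s * (1 + (r - 1) * (t / s - 1)) \<le> ?P * s * (?Q / ?P * (t / s))"
    using assms by (intro mult_left_mono) auto
  moreover have "?P * s * (?Q / ?P * (t / s)) = ?Q * t"
    using assms by simp
  moreover have "?P * s * (1 + (r - 1) * (t / s - 1)) = ?P * s - (r - 1) * ?P * (s - t)"
    using assms by (simp add: field_simps)
  ultimately have "?P * s - ?Q * t \<le> (r - 1) * ?P * (s - t)"
    by simp
  then have "(?P - ?Q) * t \<le> (r - 2) * ?P * (s - t)"
    by (simp add: algebra_simps)
  then show "\<bar>?P - ?Q\<bar> * t \<le> (r - 2) * ?P * (s - t)"
    using QP by simp
qed

section \<open>From scalars to inner product spaces\<close>

lemma weighted_difference_bounds:
  fixes \<tau> \<eta> :: "'v::real_inner" and p q r k :: real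
  assumes "norm \<eta> \<le> norm \<tau>" "\<tau> \<noteq> 0" "0 \<le> q" "q \<le> p" "0 < p" "norm \<eta> * p \<le> norm \<tau> * q"
    and "1 < r" "k \<le> 1 / 2" "k \<le> r - 1"
  shows "norm (p powr (r - 2) *\<^sub>R \<tau> - q powr (r - 2) *\<^sub>R \<eta>)
           \<le> (r + 1) * p powr (r - 2) * norm (\<tau> - \<eta>)"
    and "k * p powr (r - 2) * (norm (\<tau> - \<eta>))\<^sup>2
           \<le> (p powr (r - 2) *\<^sub>R \<tau> - q powr (r - 2) *\<^sub>R \<eta>) \<bullet> (\<tau> - \<eta>)"
proof -
  let ?P = "p powr (r - 2)" and ?Q = "q powr (r - 2)"
  let ?s = "norm \<tau>" and ?t = "norm \<eta>"
  have st: "?s - ?t \<le> norm (\<tau> - \<eta>)"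
    by (rule norm_triangle_ineq2)
  have Pst: "0 \<le> ?P * (?s - ?t)"
    using assms by simp
  \<comment> \<open>One form for both regimes: \<open>k\<close> is below both \<open>r - 1\<close>
    and 1, and \<open>r\<close> dominates both 1 and \<open>r - 2\<close>.\<close>
  have scalar: "k * ?P * (?s - ?t) \<le> ?P * ?s - ?Q * ?t \<and> \<bar>?P - ?Q\<bar> * ?t \<le> r * ?P * (?s - ?t)"
  proof (cases "r \<le> 2")
    case True
    have "k * (?P * (?s - ?t)) \<le> (r - 1) * (?P * (?s - ?t))"
      using Pst assms by (intro mult_right_mono) auto
    moreover have "1 * (?P * (?s - ?t)) \<le> r * (?P * (?s - ?t))"
      using Pst assms by (intro mult_right_mono) auto
    moreover have "(r - 1) * (?P * (?s - ?t)) \<le> ?P * ?s - ?Q * ?t"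
        "\<bar>?P - ?Q\<bar> * ?t \<le> ?P * (?s - ?t)"
      using weighted_difference_singular[of ?t ?s q p r] assms True by (simp_all add: mult.assoc)
    ultimately show ?thesis
      unfolding mult.assoc by linarith
  next
    case False
    have "k * (?P * (?s - ?t)) \<le> 1 * (?P * (?s - ?t))"
      using Pst assms by (intro mult_right_mono) auto
    moreover have "(r - 2) * (?P * (?s - ?t)) \<le> r * (?P * (?s - ?t))"
      using Pst assms by (intro mult_right_mono) auto
    moreover have "?P * (?s - ?t) \<le> ?P * ?s - ?Q * ?t"
        "\<bar>?P - ?Q\<bar> * ?t \<le> (r - 2) * (?P * (?s - ?t))"
      using weighted_difference_degenerate[of ?t ?s q p r] assms False
      by (simp_all add: mult.assoc)
    ultimately show ?thesis
      unfolding mult.assoc by linarith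
  qed

  \<comment> \<open>The difference of the weights is put on \<open>\<eta>\<close>, the shorter
    vector, where \<open>scalar\<close> controls it.\<close>
  have "norm (?P *\<^sub>R \<tau> - ?Q *\<^sub>R \<eta>) = norm (?P *\<^sub>R (\<tau> - \<eta>) + (?P - ?Q) *\<^sub>R \<eta>)"
    by (simp add: algebra_simps)
  also have "\<dots> \<le> ?P * norm (\<tau> - \<eta>) + \<bar>?P - ?Q\<bar> * ?t"
    by (rule order_trans[OF norm_triangle_ineq]) simp
  also have "\<dots> \<le> ?P * norm (\<tau> - \<eta>) + r * ?P * norm (\<tau> - \<eta>)"
  proof -
    have "r * ?P * (?s - ?t) \<le> r * ?P * norm (\<tau> - \<eta>)"
      using st assms by (intro mult_left_mono) auto
    then show ?thesis using scalar by linarith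
  qed
  finally show "norm (?P *\<^sub>R \<tau> - ?Q *\<^sub>R \<eta>) \<le> (r + 1) * ?P * norm (\<tau> - \<eta>)"
    by (simp add: algebra_simps)

  have "(k * ?P * (?s - ?t)) * (?s - ?t) \<le> (?P * ?s - ?Q * ?t) * (?s - ?t)"
    using scalar assms by (intro mult_right_mono) auto
  \<comment> \<open>The angular part: \<open>k \<le> 1 / 2\<close> pays for the factor 2, and the
    Cauchy-Schwarz gap is nonnegative.\<close>
  moreover have "2 * k * ?P * (?s * ?t - \<tau> \<bullet> \<eta>) \<le> (?P + ?Q) * (?s * ?t - \<tau> \<bullet> \<eta>)"
  proof -
    have "2 * k * ?P \<le> 1 * ?P"
      using assms by (intro mult_right_mono) auto
    moreover have "\<tau> \<bullet> \<eta> \<le> ?s * ?t"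
      by (rule norm_cauchy_schwarz)
    moreover have "0 \<le> ?Q" by simp
    ultimately show ?thesis
      by (intro mult_right_mono) linarith+
  qed
  ultimately have "k * ?P * ((?s - ?t) * (?s - ?t) + 2 * (?s * ?t - \<tau> \<bullet> \<eta>))
      \<le> (?P * ?s - ?Q * ?t) * (?s - ?t) + (?P + ?Q) * (?s * ?t - \<tau> \<bullet> \<eta>)"
    unfolding distrib_left by (intro add_mono) (simp_all only: mult.assoc mult.left_commute)
  moreover have sq: "\<tau> \<bullet> \<tau> = ?s * ?s" "\<eta> \<bullet> \<eta> = ?t * ?t" "\<eta> \<bullet> \<tau> = \<tau> \<bullet> \<eta>"
    by (simp_all add: dot_square_norm power2_eq_square inner_commute)
  \<comment> \<open>This identity and the next write both sides as a radial term plus a multiple of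
    the same angular gap, so the two bounds simply add up.\<close>
  moreover have "(norm (\<tau> - \<eta>))\<^sup>2 = (?s - ?t) * (?s - ?t) + 2 * (?s * ?t - \<tau> \<bullet> \<eta>)"
    unfolding power2_norm_eq_inner inner_diff_left inner_diff_right sq by algebra
  moreover have "(?P *\<^sub>R \<tau> - ?Q *\<^sub>R \<eta>) \<bullet> (\<tau> - \<eta>)
      = (?P * ?s - ?Q * ?t) * (?s - ?t) + (?P + ?Q) * (?s * ?t - \<tau> \<bullet> \<eta>)"
    unfolding inner_diff_left inner_diff_right inner_scaleR_left sq by algebra
  ultimately show "k * ?P * (norm (\<tau> - \<eta>))\<^sup>2 \<le> (?P *\<^sub>R \<tau> - ?Q *\<^sub>R \<eta>) \<bullet> (\<tau> - \<eta>)"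
    by (simp only:)
qed

section \<open>Power means\<close>

lemma le_powr_inverse:
  fixes w b S :: real
  assumes "0 \<le> w" "0 < b" "w powr b \<le> S"
  shows "w \<le> S powr (1 / b)"
proof -
  have "w = (w powr b) powr (1 / b)"
    using assms by (simp add: powr_powr)
  also have "\<dots> \<le> S powr (1 / b)"
    using assms by (intro powr_mono2) auto
  finally show ?thesis .
qed

lemma powr_inverse_le:
  fixes w b c S :: real
  assumes "0 \<le> w" "0 < b" "0 \<le> S" "S \<le> c * w powr b"
  shows "S powr (1 / b) \<le> c powr (1 / b) * w"
proof -
  have "S powr (1 / b) \<le> (c * w powr b) powr (1 / b)"
    using assms by (intro powr_mono2) auto
  also have "\<dots> = c powr (1 / b) * w"
    using assms by (simp add: powr_mult powr_powr)
  finally show ?thesis .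
qed

text \<open>The function \<rho> of the overview, with exponent \<open>b\<close> in place of
  a(x).\<close>

definition power_mean :: "real \<Rightarrow> real \<Rightarrow> real \<Rightarrow> real" where
  "power_mean \<delta> b t = (\<delta> powr b + t powr b) powr (1 / b)"

lemma power_mean_mono:
  assumes "0 < b" "0 \<le> t" "t \<le> s"
  shows "power_mean \<delta> b t \<le> power_mean \<delta> b s"
  using assms unfolding power_mean_def by (intro powr_mono2 add_left_mono) auto

text \<open>Once the outer factors are pulled inside the means, the mixed term in \<open>s\<close>
  and \<open>t\<close> is the same on both sides, and only the multiples of
  \<open>\<delta> powr b\<close> need comparing.\<close>

lemma power_mean_sublinear:
  assumes "0 < b" "0 \<le> t" "t \<le> s"
  shows "t * power_mean \<delta> b s \<le> s * power_mean \<delta> b t"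
proof -
  have scale: "x * power_mean \<delta> b y = (x powr b * (\<delta> powr b + y powr b)) powr (1 / b)"
    if "0 \<le> x" for x y
    using that assms by (simp add: power_mean_def powr_mult powr_powr)
  have "t powr b * \<delta> powr b \<le> s powr b * \<delta> powr b"
    using assms by (intro mult_right_mono powr_mono2) auto
  then have "(t powr b * (\<delta> powr b + s powr b)) powr (1 / b)
      \<le> (s powr b * (\<delta> powr b + t powr b)) powr (1 / b)"
    using assms by (intro powr_mono2) (auto simp: algebra_simps)
  then show ?thesis
    using assms by (simp add: scale)
qed

text \<open>Both quantities are at least \<open>max \<delta> s\<close>, and exceed it at most by the
  factors 2^(1/b) and 3^(1/r). As \<open>bm \<le> b\<close> and \<open>1 < r\<close>, the constant
  \<open>B\<close> covers both, independently of \<open>b\<close>.\<close>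

lemma power_mean_comparable_norm:
  fixes \<delta> s t b bm r :: real
  assumes "0 \<le> \<delta>" "0 \<le> t" "t \<le> s" "0 < s" "0 < bm" "bm \<le> b" "1 < r"
  defines "N \<equiv> (\<delta> powr r + s powr r + t powr r) powr (1 / r)"
    and "B \<equiv> max (2 powr (1 / bm)) 3"
  shows "power_mean \<delta> b s \<le> B * N" "N \<le> B * power_mean \<delta> b s"
    and "0 < power_mean \<delta> b s" "0 < N"
proof -
  let ?w = "max \<delta> s"
  have w: "0 < ?w" using assms by simp
  have le_w: "\<delta> powr c \<le> ?w powr c" "s powr c \<le> ?w powr c" "t powr c \<le> ?w powr c"
    if "0 < c" for c
    using assms that by (auto intro!: powr_mono2)
  have w_eq: "?w powr c \<le> \<delta> powr c + s powr c" for c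
    by (simp add: max_def)
  have w_p: "?w \<le> power_mean \<delta> b s"
    using assms w_eq[of b] unfolding power_mean_def by (intro le_powr_inverse) auto
  have w_N: "?w \<le> N"
    using assms w_eq[of r] powr_ge_zero[of t r] unfolding N_def
    by (intro le_powr_inverse) linarith+
  have "power_mean \<delta> b s \<le> 2 powr (1 / b) * ?w"
    using assms le_w[of b] w unfolding power_mean_def by (intro powr_inverse_le) auto
  also have "\<dots> \<le> B * ?w"
  proof -
    have "2 powr (1 / b) \<le> (2::real) powr (1 / bm)"
      using assms by (intro powr_mono) (auto simp: field_simps)
    then have "2 powr (1 / b) \<le> B"
      unfolding B_def by (rule max.coboundedI1)
    then show ?thesis
      using w by (intro mult_right_mono) auto
  qed
  finally have p_w: "power_mean \<delta> b s \<le> B * ?w" .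
  have "N \<le> 3 powr (1 / r) * ?w"
    using assms le_w[of r] w unfolding N_def by (intro powr_inverse_le) auto
  also have "\<dots> \<le> B * ?w"
  proof -
    have "3 powr (1 / r) \<le> (3::real) powr 1"
      using assms by (intro powr_mono) auto
    then show ?thesis
      using w unfolding B_def by (intro mult_right_mono) auto
  qed
  finally have N_w: "N \<le> B * ?w" .
  have "0 \<le> B" unfolding B_def by simp
  then have "B * ?w \<le> B * N" "B * ?w \<le> B * power_mean \<delta> b s"
    using w_N w_p by (auto intro!: mult_left_mono)
  then show "power_mean \<delta> b s \<le> B * N" "N \<le> B * power_mean \<delta> b s"
    "0 < power_mean \<delta> b s" "0 < N"
    using p_w N_w w w_p w_N by linarith+
qed

section \<open>The Carreau-Yasuda law\<close>

lemma carreau_yasuda_power_mean: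
  "carreau_yasuda \<mu> \<delta> a r x \<tau> = \<mu> x *\<^sub>R (power_mean \<delta> (a x) (norm \<tau>) powr (r - 2) *\<^sub>R \<tau>)"
  by (simp add: carreau_yasuda_def power_mean_def powr_powr)

text \<open>The constants see \<open>\<mu> x\<close> and \<open>a x\<close> only through
  \<open>\<mu>m\<close>, \<open>\<mu>p\<close> and \<open>am\<close>, hence are uniform in
  \<open>x\<close>. The factor \<open>K\<close> is the cost of exchanging the power of \<rho> for
  \<open>M\<close>, in either direction.\<close>

lemma carreau_yasuda_bounds:
  fixes \<tau> \<eta> :: "real ^ 'd ^ 'd" and \<mu> a :: "'x \<Rightarrow> real" and \<delta> r am \<mu>m \<mu>p :: real
  assumes "1 < r" "0 \<le> \<delta>" "0 < am" "am \<le> a x" "0 < \<mu>m" "\<mu>m \<le> \<mu> x" "\<mu> x \<le> \<mu>p" "\<tau> \<noteq> \<eta>"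
  defines "K \<equiv> max (2 powr (1 / am)) 3 powr \<bar>r - 2\<bar>"
    and "M \<equiv> (\<delta> powr r + norm \<tau> powr r + norm \<eta> powr r) powr ((r - 2) / r)"
    and "S \<equiv> carreau_yasuda \<mu> \<delta> a r x"
  shows "norm (S \<tau> - S \<eta>) \<le> (\<mu>p * (r + 1) * K) * M * norm (\<tau> - \<eta>) \<and>
    (\<mu>m * min (1 / 2) (r - 1) / K) * M * (norm (\<tau> - \<eta>))\<^sup>2 \<le> (S \<tau> - S \<eta>) \<bullet> (\<tau> - \<eta>)"
proof -
  \<comment> \<open>The claim is symmetric in the two matrices, so the longer one may be called
    \<open>\<tau>\<close>; they are generalized here so that the other case can use the swapped
    instance.\<close>
  have bounds: "norm (S \<tau> - S \<eta>) \<le> (\<mu>p * (r + 1) * K) * M * norm (\<tau> - \<eta>) \<and>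
      (\<mu>m * min (1 / 2) (r - 1) / K) * M * (norm (\<tau> - \<eta>))\<^sup>2 \<le> (S \<tau> - S \<eta>) \<bullet> (\<tau> - \<eta>)"
    if "\<tau> \<noteq> \<eta>" "norm \<eta> \<le> norm \<tau>"
      and M: "M = (\<delta> powr r + norm \<tau> powr r + norm \<eta> powr r) powr ((r - 2) / r)"
    for \<tau> \<eta> :: "real ^ 'd ^ 'd" and M
  proof -
    let ?p = "power_mean \<delta> (a x) (norm \<tau>)" and ?q = "power_mean \<delta> (a x) (norm \<eta>)"
    let ?N = "(\<delta> powr r + norm \<tau> powr r + norm \<eta> powr r) powr (1 / r)"
    let ?D = "?p powr (r - 2) *\<^sub>R \<tau> - ?q powr (r - 2) *\<^sub>R \<eta>"
    let ?P = "?p powr (r - 2)" and ?k = "min (1 / 2) (r - 1)" and ?n = "norm (\<tau> - \<eta>)"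
    have \<tau>: "\<tau> \<noteq> 0" using that by auto
    have a: "0 < a x" and \<mu>: "0 < \<mu> x" using assms(1-8) by linarith+
    have S: "S \<tau> - S \<eta> = \<mu> x *\<^sub>R ?D"
      by (simp add: S_def carreau_yasuda_power_mean algebra_simps)
    have MN: "M = ?N powr (r - 2)"
      by (simp add: M powr_powr)
    have K: "0 < K" unfolding K_def by simp
    have B: "(1::real) \<le> max (2 powr (1 / am)) 3" by simp
    note comp = power_mean_comparable_norm[of \<delta> "norm \<eta>" "norm \<tau>" am "a x" r]
    have PM: "?P \<le> K * M" and MP: "M \<le> K * ?P"
      unfolding K_def MN
      by (rule powr_comparable[OF _ _ _ _ B]; use comp assms(1-8) that \<tau> in simp)+
    have D: "norm ?D \<le> (r + 1) * ?P * ?n" "?k * ?P * ?n\<^sup>2 \<le> ?D \<bullet> (\<tau> - \<eta>)"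
    proof -
      have "0 < ?p"
        using comp(3) assms(1-8) that \<tau> by simp
      moreover have "?q \<le> ?p"
        using a that by (intro power_mean_mono) auto
      moreover have "norm \<eta> * ?p \<le> norm \<tau> * ?q"
        using a that by (intro power_mean_sublinear) auto
      moreover have "0 \<le> ?q"
        by (simp add: power_mean_def)
      ultimately show "norm ?D \<le> (r + 1) * ?P * ?n" "?k * ?P * ?n\<^sup>2 \<le> ?D \<bullet> (\<tau> - \<eta>)"
        using weighted_difference_bounds[of \<eta> \<tau> ?q ?p r ?k, OF _ _ _ _ _ _ _ min.cobounded1 min.cobounded2] that(2) \<tau> assms(1) by blast+
    qed
    have "norm (S \<tau> - S \<eta>) = \<mu> x * norm ?D"
      using \<mu> by (simp only: S norm_scaleR abs_of_pos)
    also have "\<dots> \<le> \<mu>p * ((r + 1) * (K * M) * ?n)"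
    proof (intro mult_mono)
      have "(r + 1) * ?P * ?n \<le> (r + 1) * (K * M) * ?n"
        using PM assms(1-8) by (intro mult_right_mono mult_left_mono) auto
      with D show "norm ?D \<le> (r + 1) * (K * M) * ?n" by linarith
    qed (use assms(1-8) in auto)
    finally have 1: "norm (S \<tau> - S \<eta>) \<le> (\<mu>p * (r + 1) * K) * M * ?n"
      by (simp add: mult_ac)
    have "(\<mu>m * ?k / K) * M * ?n\<^sup>2 = \<mu>m * (?k * (M / K) * ?n\<^sup>2)"
      by simp
    also have "\<dots> \<le> \<mu> x * (?D \<bullet> (\<tau> - \<eta>))"
    proof (intro mult_mono)
      have "M / K \<le> ?P" using MP K by (simp add: field_simps)
      then have "?k * (M / K) * ?n\<^sup>2 \<le> ?k * ?P * ?n\<^sup>2"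
        using assms(1-8) by (intro mult_right_mono mult_left_mono) auto
      with D show "?k * (M / K) * ?n\<^sup>2 \<le> ?D \<bullet> (\<tau> - \<eta>)" by linarith
      show "0 \<le> ?k * (M / K) * ?n\<^sup>2"
        using assms(1-8) K by (auto simp: M)
    qed (use assms(1-8) in auto)
    also have "\<dots> = (S \<tau> - S \<eta>) \<bullet> (\<tau> - \<eta>)"
      by (simp add: S)
    finally show ?thesis using 1 by simp
  qed
  show ?thesis
  proof (cases "norm \<eta> \<le> norm \<tau>")
    case True
    then show ?thesis using bounds[OF assms(8) True] M_def by simp
  next
    case False
    have "(S \<eta> - S \<tau>) \<bullet> (\<eta> - \<tau>) = (S \<tau> - S \<eta>) \<bullet> (\<tau> - \<eta>)"
      by (simp add: inner_diff algebra_simps)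
    then show ?thesis
      using bounds[of \<eta> \<tau> M] assms(8) False
      by (simp add: M_def norm_minus_commute add_ac)
  qed
qed

theorem corollary24:
  fixes \<Omega> :: "(real ^ 'd) set"
    and r \<delta> \<mu>m \<mu>p am ap :: real
    and \<mu> a :: "real ^ 'd \<Rightarrow> real"
    and \<sigma> :: "real ^ 'd \<Rightarrow> real ^ 'd ^ 'd \<Rightarrow> real ^ 'd ^ 'd"
  assumes "CARD('d) \<in> {2, 3}"
    and "bounded \<Omega>" and "connected \<Omega>" and "open \<Omega>"
    and "polyhedral_domain \<Omega>" and "lipschitz_boundary \<Omega>"
    and "1 < r" and "0 \<le> \<delta>"
    and "0 < \<mu>m" and "0 < \<mu>p" and "0 < am" and "0 < ap"
    and "\<mu> \<in> borel_measurable (lebesgue_on \<Omega>)" and "\<mu> \<in> \<Omega> \<rightarrow> {\<mu>m..\<mu>p}"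
    and "a \<in> borel_measurable (lebesgue_on \<Omega>)" and "a \<in> \<Omega> \<rightarrow> {am..ap}"
    and "AE x in lebesgue_on \<Omega>. \<forall>\<tau>\<in>sym_matrices. \<sigma> x \<tau> = carreau_yasuda \<mu> \<delta> a r x \<tau>"
  shows "power_framed \<Omega> r \<sigma>"
proof -
  define K where "K = max (2 powr (1 / am)) 3 powr \<bar>r - 2\<bar>"
  define hc where "hc = \<mu>p * (r + 1) * K"
  define sm where "sm = \<mu>m * min (1 / 2) (r - 1) / K"
  have "0 < K" by (simp add: K_def)
  then have pos: "0 < hc" "0 < sm"
    using assms(7,9,10) by (simp_all add: hc_def sm_def)
  have bound: "AE x in lebesgue_on \<Omega>.
      norm (\<sigma> x \<tau> - \<sigma> x \<eta>)
        \<le> hc * (\<delta> powr r + norm \<tau> powr r + norm \<eta> powr r) powr ((r - 2) / r) * norm (\<tau> - \<eta>) \<and>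
      (\<sigma> x \<tau> - \<sigma> x \<eta>) \<bullet> (\<tau> - \<eta>)
        \<ge> sm * (\<delta> powr r + norm \<tau> powr r + norm \<eta> powr r) powr ((r - 2) / r)
            * (norm (\<tau> - \<eta>))\<^sup>2"
    if "\<tau> \<in> sym_matrices" "\<eta> \<in> sym_matrices" "\<tau> \<noteq> \<eta>" for \<tau> \<eta>
    \<comment> \<open>\<open>AE_space\<close> supplies membership in \<open>\<Omega>\<close>, where
      the bounds on \<open>\<mu>\<close> and \<open>a\<close> hold pointwise.\<close>
    using assms(17) AE_space
  proof eventually_elim
    case (elim x)
    then have x: "am \<le> a x" "\<mu>m \<le> \<mu> x" "\<mu> x \<le> \<mu>p"
      using assms(14,16) by auto
    have \<sigma>: "\<sigma> x \<tau> = carreau_yasuda \<mu> \<delta> a r x \<tau>" "\<sigma> x \<eta> = carreau_yasuda \<mu> \<delta> a r x \<eta>"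
      using elim that by blast+
    show ?case
      unfolding \<sigma> hc_def sm_def K_def
      by (rule carreau_yasuda_bounds) (fact assms(7,8,9,11) x that)+
  qed
  show ?thesis
    unfolding power_framed_def
    by (rule exI[of _ \<delta>], rule exI[of _ hc], rule exI[of _ sm])
      (use assms(8) pos bound in blast)
qed

end
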